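(* Let $p$ be a prime, let $2\le s\le p-1$, and let $n$ be a positive integer. Let $$L=\{0,1,\dots,s-1\}\subseteq\mathbb{F}_p,$$ and let $K\subseteq\mathbb{F}_p\setminus L$. Call a family $\mathcal{F}$ of subsets of $[n]$ admissible if (i) $|F| \bmod p\in K$ for every $F\in\mathcal{F}$; (ii) $|E\cap F|\bmod p\in L$ for all distinct $E,F\in\mathcal{F}$. Then every admissible family $\mathcal{F}$ satisfies $$|\mathcal{F}|\le\binom{n}{s}.$$ Moreover, if $s\in K$, then $\mathcal{F}=\binom{[n]}{s}$ is admissible and attains equality. In particular, whenever $|K|=r$ with $2\le r\le s$, and $n\ge s$, the bound $N(n,s,r)$ is not attainable, i.e. no admissible family $\mathcal{F}$ satisfies $|\mathcal{F}|=N(n,s,r)$.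
   Context: Here $[n]=\{1,\dots,n\}$, $\binom{[n]}{s}$ is the set of all $s$-element subsets of $[n]$, and integers in $\{0,\dots,p-1\}$ are identified with their residues in $\mathbb{F}_p$. For $1\le r\le s$, $N(n,s,r)=\binom{n}{s}+\binom{n}{s-1}+\cdots+\binom{n}{s-r+1}$. *)

theory Defs
  imports "HOL-Computational_Algebra.Primes" "HOL-Library.Ramsey"
begin

text \<open>The elements of the prime field are represented by the residues \<open>{0..<p}\<close>,
  so that \<open>K\<close> and \<open>L\<close> are subsets of \<open>{0..<p}\<close>.\<close>

definition admissible :: "nat \<Rightarrow> nat \<Rightarrow> nat set \<Rightarrow> nat set \<Rightarrow> nat set set \<Rightarrow> bool" where
  "admissible p n K L \<F> \<longleftrightarrow>
     \<F> \<subseteq> Pow {1..n} \<and>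
     (\<forall>F\<in>\<F>. card F mod p \<in> K) \<and>
     (\<forall>E\<in>\<F>. \<forall>F\<in>\<F>. E \<noteq> F \<longrightarrow> card (E \<inter> F) mod p \<in> L)"

text \<open>Meant for \<open>1 \<le> r \<le> s\<close>, where the subtraction does not truncate.\<close>

definition N :: "nat \<Rightarrow> nat \<Rightarrow> nat \<Rightarrow> nat" where
  "N n s r = (\<Sum>i<r. n choose (s - i))"

end

theory Submission
  imports Defs "HOL.Binomial_Plus"
begin

text \<open>For \<open>s < p\<close> the binomial coefficient \<open>m choose s\<close> is divisible by \<open>p\<close> iff
  \<open>m mod p < s\<close>. Since \<open>card (E \<inter> F) choose s\<close> counts the \<open>s\<close>-subsets common to \<open>E\<close> and \<open>F\<close>,
  the vectors recording which \<open>s\<close>-subsets of \<open>[n]\<close> lie in \<open>F\<close>, for \<open>F \<in> \<F>\<close>, are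
  pairwise orthogonal and non-isotropic over the field with \<open>p\<close> elements. They are therefore
  linearly independent, and their number is at most the dimension \<open>n choose s\<close>.\<close>

text \<open>The combination map from coefficients to vectors over the field with \<open>p\<close> elements is
  injective, so comparing the cardinalities of these finite spaces replaces a dimension argument.\<close>

lemma card_le_if_orthogonal_mod_prime:
  fixes w :: "'a \<Rightarrow> 'b \<Rightarrow> int" and p :: nat
  assumes p: "prime p" and A: "finite A" and B: "finite B"
    and diag: "\<And>x. x \<in> A \<Longrightarrow> \<not> int p dvd (\<Sum>b\<in>B. w x b * w x b)"
    and offdiag: "\<And>x y. x \<in> A \<Longrightarrow> y \<in> A \<Longrightarrow> x \<noteq> y \<Longrightarrow> int p dvd (\<Sum>b\<in>B. w x b * w y b)"
  shows "card A \<le> card B"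
proof -
  have p1: "int p > 1" using prime_gt_1_nat[OF p] by simp
  define C where "C = {0..<int p}"
  have C: "finite C" "card C = p" by (auto simp: C_def)
  \<comment> \<open>Reducing mod \<open>p\<close> and restricting to \<open>B\<close> puts every
    combination into a function space with \<open>p ^ card B\<close> elements.\<close>
  define \<phi> where "\<phi> = (\<lambda>c::'a \<Rightarrow> int. \<lambda>b\<in>B. (\<Sum>x\<in>A. c x * w x b) mod int p)"
  have "inj_on \<phi> (PiE A (\<lambda>_. C))"
  proof (rule inj_onI)
    fix c d assume c: "c \<in> PiE A (\<lambda>_. C)" and d: "d \<in> PiE A (\<lambda>_. C)" and eq: "\<phi> c = \<phi> d"
    have rel: "int p dvd (\<Sum>x\<in>A. (c x - d x) * w x b)" if "b \<in> B" for b
      using fun_cong[OF eq, of b] that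
      by (simp add: \<phi>_def mod_eq_dvd_iff sum_subtractf left_diff_distrib)
    show "c = d"
    proof (rule PiE_ext[OF c d])
      fix y assume y: "y \<in> A"
      \<comment> \<open>Pairing \<open>rel\<close> with the vector \<open>w y\<close> isolates the
        coefficient at \<open>y\<close>: the terms with \<open>x \<noteq> y\<close> vanish mod
        \<open>p\<close> by \<open>offdiag\<close>, and by \<open>diag\<close> the factor left at
        \<open>y\<close> is a unit mod \<open>p\<close>.\<close>
      have rest: "int p dvd (\<Sum>x\<in>A-{y}. (c x - d x) * (\<Sum>b\<in>B. w x b * w y b))"
        using y by (intro dvd_sum dvd_mult offdiag) auto
      have "int p dvd (\<Sum>b\<in>B. (\<Sum>x\<in>A. (c x - d x) * w x b) * w y b)"
        by (intro dvd_sum dvd_mult2 rel)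
      also have "\<dots> = (\<Sum>x\<in>A. (c x - d x) * (\<Sum>b\<in>B. w x b * w y b))"
        by (simp add: sum_distrib_right sum_distrib_left sum.swap[of _ B A] mult.assoc)
      also have "\<dots> = (c y - d y) * (\<Sum>b\<in>B. w y b * w y b)
          + (\<Sum>x\<in>A-{y}. (c x - d x) * (\<Sum>b\<in>B. w x b * w y b))"
        using A y by (rule sum.remove)
      finally have "int p dvd (c y - d y) * (\<Sum>b\<in>B. w y b * w y b)"
        using rest by (simp only: dvd_add_left_iff)
      then have "int p dvd c y - d y"
        using diag[OF y] p by (simp add: prime_dvd_mult_iff)
      then have "c y mod int p = d y mod int p" by (simp add: mod_eq_dvd_iff)
      moreover have "c y \<in> C" "d y \<in> C" using c d y by auto
      ultimately show "c y = d y" by (simp add: C_def)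
    qed
  qed
  moreover have "\<phi> ` PiE A (\<lambda>_. C) \<subseteq> PiE B (\<lambda>_. C)"
    using p1 by (auto simp: \<phi>_def C_def)
  ultimately have "card (PiE A (\<lambda>_. C)) \<le> card (PiE B (\<lambda>_. C))"
    using B C by (intro card_inj_on_le[of \<phi>] finite_PiE) auto
  then have "p ^ card A \<le> p ^ card B"
    using A B C by (simp add: card_PiE)
  then show ?thesis using p1 by simp
qed

text \<open>Multiplying by \<open>fact s\<close>, a unit mod \<open>p\<close> because
  \<open>s < p\<close>, gives the falling factorial of \<open>m\<close>. As \<open>p\<close> is
  prime, it divides this product iff it divides some factor \<open>m - i\<close> with
  \<open>i < s\<close>.\<close>

lemma prime_dvd_binomial_iff_mod_less:
  fixes p m s :: nat
  assumes p: "prime p" and s: "s < p"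
  shows "p dvd m choose s \<longleftrightarrow> m mod p < s"
proof -
  have "fact s * int (m choose s) = (\<Prod>i<s. int m - int i)"
    by (simp add: int_binomial gbinomial_int_mult_fact atLeast0LessThan)
  then have "int p dvd fact s * int (m choose s) \<longleftrightarrow> (\<exists>i<s. int p dvd int m - int i)"
    using p by (auto simp: prime_dvd_prod_iff)
  moreover have "int p dvd fact s * int (m choose s) \<longleftrightarrow> p dvd m choose s"
  proof -
    have "\<not> p dvd fact s" using p s by (simp add: prime_dvd_fact_iff)
    then have "\<not> int p dvd fact s" by (metis of_nat_fact int_dvd_int_iff)
    then show ?thesis using p by (simp add: prime_dvd_mult_iff)
  qed
  moreover have "int p dvd int m - int i \<longleftrightarrow> m mod p = i" if "i < s" for i
    using that s by (simp flip: mod_eq_dvd_iff of_nat_mod)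
  ultimately show ?thesis by auto
qed

theorem corollary9:
  fixes p s n :: nat and K L :: "nat set"
  assumes "prime p"
    and "2 \<le> s" and "s \<le> p - 1"
    and "n > 0"
    and "L = {0..s - 1}"
    and "K \<subseteq> {0..<p} - L"
  shows "(\<forall>\<F>. admissible p n K L \<F> \<longrightarrow> card \<F> \<le> n choose s) \<and>
         (s \<in> K \<longrightarrow> admissible p n K L (nsets {1..n} s) \<and>
                      card (nsets {1..n} s) = n choose s) \<and>
         (\<forall>r. card K = r \<and> 2 \<le> r \<and> r \<le> s \<and> n \<ge> s \<longrightarrow>
              \<not> (\<exists>\<F>. admissible p n K L \<F> \<and> card \<F> = N n s r))"
proof -
  have sp: "s < p" using assms(2,3) by linarith
  have L: "k \<in> L \<longleftrightarrow> k < s" for k using assms(2,5) by auto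
  have bound: "card \<F> \<le> n choose s" if adm: "admissible p n K L \<F>" for \<F>
  proof -
    have sub: "\<F> \<subseteq> Pow {1..n}" using adm by (simp add: admissible_def)
    define w :: "nat set \<Rightarrow> nat set \<Rightarrow> int" where "w = (\<lambda>F S. of_bool (S \<subseteq> F))"
    have gram: "(\<Sum>S\<in>nsets {1..n} s. w E S * w F S) = int (card (E \<inter> F) choose s)"
      if "E \<in> \<F>" for E F
    proof -
      have "E \<subseteq> {1..n}" using that sub by auto
      \<comment> \<open>An \<open>s\<close>-set inside \<open>E \<inter> F\<close> lies in
        \<open>{1..n}\<close> automatically, so no common \<open>s\<close>-subset is missed by the
        index set.\<close>
      then have "nsets {1..n} s \<inter> {S. S \<subseteq> E \<inter> F} = nsets (E \<inter> F) s"
        by (auto simp: nsets_def)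
      moreover have "finite (nsets {1..n} s)" by (simp add: finite_imp_finite_nsets)
      ultimately show ?thesis
        by (simp add: w_def flip: of_bool_conj)
    qed
    have "card \<F> \<le> card (nsets {1..n} s)"
    proof (rule card_le_if_orthogonal_mod_prime[OF assms(1), where w = w])
      show "finite \<F>" using sub by (rule finite_subset) simp
      show "finite (nsets {1..n} s)" by (simp add: finite_imp_finite_nsets)
    next
      fix F assume F: "F \<in> \<F>"
      then have "\<not> card F mod p < s"
        using adm assms(6) L by (auto simp: admissible_def)
      then show "\<not> int p dvd (\<Sum>S\<in>nsets {1..n} s. w F S * w F S)"
        unfolding gram[OF F] by (simp add: prime_dvd_binomial_iff_mod_less assms(1) sp)
    next
      fix E F assume EF: "E \<in> \<F>" "F \<in> \<F>" "E \<noteq> F"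
      then have "card (E \<inter> F) mod p < s"
        using adm L by (auto simp: admissible_def)
      then show "int p dvd (\<Sum>S\<in>nsets {1..n} s. w E S * w F S)"
        unfolding gram[OF EF(1)] by (simp add: prime_dvd_binomial_iff_mod_less assms(1) sp)
    qed
    then show ?thesis by simp
  qed
  have complete: "admissible p n K L (nsets {1..n} s)" if "s \<in> K"
    unfolding admissible_def
  proof (intro conjI ballI impI)
    fix E F assume EF: "E \<in> nsets {1..n} s" "F \<in> nsets {1..n} s" "E \<noteq> F"
    then have fin: "finite E" "finite F" "card E = s" "card F = s" by (auto simp: nsets_def)
    \<comment> \<open>\<open>E\<close> and \<open>F\<close> have equal size, so
      \<open>E \<subseteq> F\<close> would force \<open>E = F\<close>.\<close>
    then have "E \<inter> F \<subset> E" using EF(3) card_subset_eq[of F E] by auto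
    then have "card (E \<inter> F) < s" using fin psubset_card_mono by blast
    then show "card (E \<inter> F) mod p \<in> L" using sp by (simp add: L)
  qed (use that sp in \<open>auto simp: nsets_def\<close>)
  have "n choose s < N n s r" if "2 \<le> r" "r \<le> s" "s \<le> n" for r
  proof -
    \<comment> \<open>The first two summands of \<open>N n s r\<close> already exceed the bound,
      since \<open>n choose (s - 1)\<close> is positive for \<open>s \<le> n\<close>.\<close>
    have "n choose s < (\<Sum>i<2. n choose (s - i))"
      using that by (simp add: numeral_2_eq_2)
    also have "\<dots> \<le> N n s r"
      unfolding N_def using that(1) by (intro sum_mono2) auto
    finally show ?thesis .
  qed
  then show ?thesis using bound complete by (fastforce simp: not_le)
qed

end
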